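(* Let $\mathcal C\subset\mathbb R^2$ be a compact convex set, $O$ an interior point of it, and let $\tilde f(\varphi):=|\tilde A(\varphi)\tilde B(\varphi)|$ where $[\tilde A(\varphi)\tilde B(\varphi)]=l(\varphi)\cap\mathcal C$. Suppose $\varphi_*$ is a local minimum for $\tilde f(\varphi)$ and let $[A^*B^*]=l(\varphi_* )\cap\mathcal C$. Then: (i) CPP holds for every pair of lines $l_1,l_2$ with $l_1$ supporting $\mathcal C$ at $A^*$ and $l_2$ supporting $\mathcal C$ at $B^*$, and the point $O\in[A^*B^*]$; that is, the perpendicular to $l_1$ at $A^*$, the perpendicular to $l_2$ at $B^*$ and the perpendicular to the line $A^*B^*$ at $O$ have a common point. (ii) At each of the end-points $A^*$ and $B^*$ there exists only one supporting line for $\mathcal C$. (iii) $\tilde f(\varphi)$ is differentiable at $\varphi_*$ and $\tilde f'(\varphi_* )=0$.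
   Context: $l(\varphi)$ denotes the line through $O$ obtained by rotating a fixed line through $O$ by the angle $\varphi$ (in radians) around $O$. $|AB|$ is the length of the segment $[AB]$. A line $p$ is supporting for $\mathcal C\subset\mathbb R^2$ at $A\in\mathcal C$ if $A\in p$ and $\mathcal C$ lies entirely in one of the two closed half-planes determined by $p$. CPP (Concurrent Perpendiculars Property) for lines $l_1\ni A$, $l_2\ni B$, a line $l$ passing through $A,B,O$, and the points $A,B,O$: the perpendicular to $l_1$ at $A$, the perpendicular to $l_2$ at $B$ and the perpendicular to $l$ at $O$ have a common point. *)

theory Defs
  imports "HOL-Analysis.Analysis"
begin

definition is_line :: "(real^2) set \<Rightarrow> bool" where
  "is_line p \<longleftrightarrow> affine p \<and> aff_dim p = 1"

definition rotate_about :: "real^2 \<Rightarrow> real \<Rightarrow> real^2 \<Rightarrow> real^2" where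
  "rotate_about Z \<phi> X = Z + vector [cos \<phi> * (X - Z) $ 1 - sin \<phi> * (X - Z) $ 2,
                                   sin \<phi> * (X - Z) $ 1 + cos \<phi> * (X - Z) $ 2]"

definition rotated_line :: "real^2 \<Rightarrow> (real^2) set \<Rightarrow> real \<Rightarrow> (real^2) set" where
  "rotated_line Z l0 \<phi> = rotate_about Z \<phi> ` l0"

definition segment_length :: "(real^2) set \<Rightarrow> real" where
  "segment_length S = (THE d. \<exists>A B. S = closed_segment A B \<and> d = dist A B)"

lemma segment_length_closed_segment [simp]: "segment_length (closed_segment A B) = dist A B"
  unfolding segment_length_def
  by (rule the_equality) (auto simp: closed_segment_eq doubleton_eq_iff dist_commute)

(* The two closed half-planes determined by the line {x. n \<bullet> x = b} are {x. n \<bullet> x \<le> b} and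
   {x. n \<bullet> x \<ge> b}; replacing (n, b) by (-n, -b) exchanges them, so one inequality suffices. *)
definition supporting_line :: "(real^2) set \<Rightarrow> real^2 \<Rightarrow> (real^2) set \<Rightarrow> bool" where
  "supporting_line C A p \<longleftrightarrow> A \<in> C \<and> A \<in> p \<and>
     (\<exists>n b. n \<noteq> 0 \<and> p = {x. n \<bullet> x = b} \<and> C \<subseteq> {x. n \<bullet> x \<le> b})"

definition perpendicular_at :: "(real^2) set \<Rightarrow> real^2 \<Rightarrow> (real^2) set" where
  "perpendicular_at p A = {X. \<forall>Y\<in>p. \<forall>Y'\<in>p. orthogonal (X - A) (Y - Y')}"

definition CPP :: "(real^2) set \<Rightarrow> (real^2) set \<Rightarrow> (real^2) set \<Rightarrow>
    real^2 \<Rightarrow> real^2 \<Rightarrow> real^2 \<Rightarrow> bool" where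
  "CPP l1 l2 l A B Z \<longleftrightarrow>
     is_line l1 \<and> is_line l2 \<and> is_line l \<and> A \<in> l1 \<and> B \<in> l2 \<and> A \<in> l \<and> B \<in> l \<and> Z \<in> l \<and>
     perpendicular_at l1 A \<inter> perpendicular_at l2 B \<inter> perpendicular_at l Z \<noteq> {}"

definition local_min_at :: "(real \<Rightarrow> real) \<Rightarrow> real \<Rightarrow> bool" where
  "local_min_at f x \<longleftrightarrow> (\<forall>\<^sub>F y in nhds x. f x \<le> f y)"

end

theory Submission
  imports Defs
begin

text \<open>Write \<open>w = As - Z\<close>, so that \<open>Bs = Z - k w\<close> with \<open>k > 0\<close>. For supporting lines at \<open>As\<close> and
  \<open>Bs\<close> with normals \<open>n\<close> and \<open>m\<close>, the strip or wedge they bound contains \<open>C\<close>, and its chord through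
  \<open>Z\<close> at angle \<open>h\<close> from \<open>w\<close> has length
  \<open>g h = norm w * (1 / (cos h + p * sin h) + k / (cos h + q * sin h))\<close>, where \<open>p\<close> and \<open>q\<close> are the
  slopes of \<open>n\<close> and \<open>m\<close> relative to \<open>w\<close>. Hence \<open>f \<phi>s \<le> f (\<phi>s + h) \<le> g h\<close> with equality at
  \<open>h = 0\<close>, which forces \<open>g' 0 = - norm w * (p + k * q) = 0\<close> and squeezes \<open>f\<close> to derivative zero. The relation
  \<open>p = - k * q\<close> says that the three perpendiculars meet at \<open>Z\<close> shifted by \<open>- p\<close> times the quarter
  turn of \<open>w\<close>, and it determines each of the two supporting lines from the other.\<close>

section \<open>Plane rotations through the quarter turn\<close>

definition quarter_turn :: "real^2 \<Rightarrow> real^2" where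
  "quarter_turn v = vector [- v $ 2, v $ 1]"

lemma inner_quarter_turn_self [simp]: "quarter_turn v \<bullet> v = 0" "v \<bullet> quarter_turn v = 0"
  by (auto simp: quarter_turn_def inner_vec_def sum_2)

lemma norm_cos_sin_quarter_turn:
  "norm (cos h *\<^sub>R w + sin h *\<^sub>R quarter_turn w) = norm w"
proof -
  have "(c * x - s * y)\<^sup>2 + (c * y + s * x)\<^sup>2 = (s\<^sup>2 + c\<^sup>2) * (x\<^sup>2 + y\<^sup>2)" for c s x y :: real
    by (simp add: power2_eq_square algebra_simps)
  from this[of "cos h" _ "sin h"] show ?thesis
    by (simp add: norm_vec_def L2_set_def sum_2 quarter_turn_def)
qed

text \<open>The vector \<open>w\<close> and its quarter turn are orthogonal and of equal length, so
  this is Parseval's identity multiplied through by \<open>w \<bullet> w\<close>.\<close>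

lemma inner_quarter_turn_decomposition:
  "(w \<bullet> w) * (x \<bullet> y) = (x \<bullet> w) * (y \<bullet> w) + (x \<bullet> quarter_turn w) * (y \<bullet> quarter_turn w)"
  by (simp add: quarter_turn_def inner_vec_def sum_2 algebra_simps)

lemma rotate_about_conv_quarter_turn:
  "rotate_about Z \<phi> X = Z + (cos \<phi> *\<^sub>R (X - Z) + sin \<phi> *\<^sub>R quarter_turn (X - Z))"
  by (simp add: rotate_about_def quarter_turn_def vec_eq_iff forall_2 algebra_simps)

text \<open>The addition formulas for \<open>cos\<close> and \<open>sin\<close> re-base the
  rotation: angles are now measured from \<open>w\<close> in place of \<open>v\<close>.\<close>

lemma cos_sin_quarter_turn_add:
  assumes "w = cos \<phi> *\<^sub>R v + sin \<phi> *\<^sub>R quarter_turn v"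
  shows "cos (\<phi> + h) *\<^sub>R v + sin (\<phi> + h) *\<^sub>R quarter_turn v = cos h *\<^sub>R w + sin h *\<^sub>R quarter_turn w"
  unfolding assms
  by (simp add: quarter_turn_def vec_eq_iff forall_2 cos_add sin_add algebra_simps)

section \<open>Lines through the centre and their rotations\<close>

lemma is_line_hyperplane: "n \<noteq> 0 \<Longrightarrow> is_line {x. n \<bullet> x = b}"
  by (simp add: is_line_def affine_hyperplane)

lemma is_line_eq_range:
  assumes "is_line l" "A \<in> l" "B \<in> l" "A \<noteq> B"
  shows "l = range (\<lambda>t. A + t *\<^sub>R (B - A))"
proof -
  have "affine hull {A, B} = l"
    using assms by (intro affine_dim_equal) (auto simp: is_line_def aff_dim_2 hull_minimal)
  then show ?thesis
    by (simp add: affine_hull_2_alt)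
qed

text \<open>A point \<open>A\<close> other than \<open>Z\<close> fixes the direction of the line at
  angle \<phi>, and turning \<open>A - Z\<close> by \<open>h\<close> then gives the direction at
  angle \<open>\<phi> + h\<close>. With \<open>A\<close> a chord endpoint, \<open>h\<close> is the
  deviation from that chord.\<close>

lemma rotated_line_eq_range:
  assumes "is_line l0" "Z \<in> l0" "A \<in> rotated_line Z l0 \<phi>" "A \<noteq> Z"
  shows "rotated_line Z l0 (\<phi> + h)
    = range (\<lambda>t. Z + t *\<^sub>R (cos h *\<^sub>R (A - Z) + sin h *\<^sub>R quarter_turn (A - Z)))"
proof -
  obtain X where X: "X \<in> l0" "A = rotate_about Z \<phi> X"
    using assms(3) by (auto simp: rotated_line_def)
  define v where "v = X - Z"
  have w: "A - Z = cos \<phi> *\<^sub>R v + sin \<phi> *\<^sub>R quarter_turn v"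
    by (simp add: X rotate_about_conv_quarter_turn v_def)
  then have "X \<noteq> Z"
    using \<open>A \<noteq> Z\<close> by (auto simp: v_def quarter_turn_def vec_eq_iff forall_2)
  then have "l0 = range (\<lambda>t. Z + t *\<^sub>R v)"
    unfolding v_def using assms X by (intro is_line_eq_range) auto
  moreover have "rotate_about Z (\<phi> + h) (Z + t *\<^sub>R v)
      = Z + t *\<^sub>R (cos h *\<^sub>R (A - Z) + sin h *\<^sub>R quarter_turn (A - Z))" for t
    unfolding cos_sin_quarter_turn_add[OF w, symmetric] rotate_about_conv_quarter_turn
    by (simp add: quarter_turn_def vec_eq_iff forall_2 algebra_simps)
  ultimately show ?thesis
    by (simp add: rotated_line_def image_image)
qed

lemma rotated_line_obtain_direction:
  assumes "is_line l0" "Z \<in> l0"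
  obtains v where "v \<noteq> 0" "rotated_line Z l0 \<phi> = range (\<lambda>t. Z + t *\<^sub>R v)"
proof -
  have "l0 \<noteq> {Z}"
    using assms by (auto simp: is_line_def)
  then obtain X where X: "X \<in> l0" "X \<noteq> Z"
    using assms by blast
  define A where "A = rotate_about Z \<phi> X"
  have "norm (A - Z) = norm (X - Z)"
    by (simp add: A_def rotate_about_conv_quarter_turn norm_cos_sin_quarter_turn)
  then have "A - Z \<noteq> 0"
    using X by auto
  moreover have "rotated_line Z l0 (\<phi> + 0) = range (\<lambda>t. Z + t *\<^sub>R (A - Z))"
    using rotated_line_eq_range[OF assms, of A \<phi> 0] X \<open>A - Z \<noteq> 0\<close>
    by (auto simp: A_def rotated_line_def)
  ultimately show thesis
    using that[of "A - Z"] by simp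
qed

section \<open>Chord endpoints and supporting lines\<close>

lemma chord_endpoint_not_interior:
  fixes C :: "'a::euclidean_space set"
  assumes "v \<noteq> 0" "closed_segment A B = range (\<lambda>t. Z + t *\<^sub>R v) \<inter> C"
  shows "A \<notin> interior C"
proof
  assume "A \<in> interior C"
  then obtain r where r: "r > 0" "cball A r \<subseteq> C"
    by (meson mem_interior_cball)
  \<comment> \<open>Scaling to length \<open>r\<close> keeps \<open>A + e\<close> and
    \<open>A - e\<close> in the ball, hence in the chord; \<open>A\<close> is then the midpoint of a
    nondegenerate subsegment, although endpoints are extreme.\<close>
  define e where "e = (r / norm v) *\<^sub>R v"
  have e: "norm e = r" "e \<noteq> 0"
    using r \<open>v \<noteq> 0\<close> by (auto simp: e_def)
  have "A \<in> range (\<lambda>t. Z + t *\<^sub>R v)"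
    using assms(2) by auto
  then obtain t where "A = Z + t *\<^sub>R v"
    by blast
  then have "A + e = Z + (t + r / norm v) *\<^sub>R v" "A - e = Z + (t - r / norm v) *\<^sub>R v"
    by (auto simp: e_def algebra_simps)
  moreover have "A + e \<in> C" "A - e \<in> C"
    using r e by (auto simp: subset_iff dist_norm)
  ultimately have "A + e \<in> closed_segment A B" "A - e \<in> closed_segment A B"
    unfolding assms(2) by auto
  moreover have "A \<in> open_segment (A + e) (A - e)"
  proof -
    have "midpoint (A + e) (A - e) = A"
      by (simp add: midpoint_def flip: scaleR_2)
    moreover have "A + e \<noteq> A - e"
    proof
      assume "A + e = A - e"
      then have "(A + e) - (A - e) = 0"
        by simp
      then have "2 *\<^sub>R e = 0"
        by (simp add: scaleR_2)
      then show False
        using e(2) by simp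
    qed
    ultimately show ?thesis
      by (metis midpoint_in_open_segment)
  qed
  moreover have "A extreme_point_of closed_segment A B"
    by (simp add: extreme_point_of_segment)
  ultimately show False
    by (auto simp: extreme_point_of_def)
qed

lemma supporting_lineE:
  assumes "supporting_line C A p"
  obtains n where "n \<noteq> 0" "p = {x. n \<bullet> x = n \<bullet> A}" "\<And>x. x \<in> C \<Longrightarrow> n \<bullet> x \<le> n \<bullet> A"
  using assms that unfolding supporting_line_def by blast

lemma supporting_line_exists:
  assumes "convex C" "interior C \<noteq> {}" "A \<in> C" "A \<notin> interior C"
  shows "\<exists>p. supporting_line C A p"
proof -
  obtain a where a: "a \<noteq> 0" "\<And>y. y \<in> C \<Longrightarrow> a \<bullet> A \<le> a \<bullet> y"
    using supporting_hyperplane_rel_boundary[of C A] assms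
    by (metis rel_interior_nonempty_interior)
  \<comment> \<open>The separating functional \<open>a\<close> is minimal at \<open>A\<close>, while
    \<open>supporting_line\<close> asks for a maximum; hence the sign change.\<close>
  have "supporting_line C A {x. (- a) \<bullet> x = (- a) \<bullet> A}"
    unfolding supporting_line_def using a assms
    by (intro conjI exI[of _ "- a"] exI[of _ "(- a) \<bullet> A"]) auto
  then show ?thesis ..
qed

lemma interior_point_strict_support:
  fixes n :: "'a::euclidean_space"
  assumes "n \<noteq> 0" "\<And>x. x \<in> C \<Longrightarrow> n \<bullet> x \<le> b" "Z \<in> interior C"
  shows "n \<bullet> Z < b"
proof -
  have "C \<subseteq> {x. n \<bullet> x \<le> b}"
    using assms(2) by auto
  then have "interior C \<subseteq> {x. n \<bullet> x < b}"
    using interior_mono interior_halfspace_le[OF assms(1)] by metis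
  then show ?thesis
    using assms(3) by auto
qed

section \<open>Squeezing the chord length near a local minimum\<close>

lemma local_min_squeeze:
  fixes f g :: "real \<Rightarrow> real"
  assumes "local_min_at f x" "\<forall>\<^sub>F h in nhds 0. f (x + h) \<le> g h" "g 0 = f x"
    and g: "(g has_real_derivative D) (at 0)"
  shows "D = 0" "(f has_real_derivative 0) (at x)"
proof -
  have "filterlim (\<lambda>h. x + h) (nhds x) (nhds 0)"
    using tendsto_add[OF tendsto_const[of x] filterlim_ident[of "nhds 0"]] by simp
  then have "\<forall>\<^sub>F h in nhds 0. f x \<le> f (x + h)"
    using assms(1) unfolding local_min_at_def by (rule eventually_compose_filterlim[rotated])
  with assms(2) have bnd: "\<forall>\<^sub>F h in nhds 0. f x \<le> f (x + h) \<and> f (x + h) \<le> g h"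
    by eventually_elim auto
  \<comment> \<open>The chain \<open>g 0 = f x \<le> f (x + h) \<le> g h\<close> passes the local
    minimum on to \<open>g\<close>, whose differentiability is known, so Fermat's rule applies to
    it.\<close>
  then have "\<forall>\<^sub>F h in nhds 0. g 0 \<le> g h"
    by eventually_elim (use assms(3) in auto)
  then obtain d where "d > 0" "\<And>h. dist h 0 < d \<Longrightarrow> g 0 \<le> g h"
    by (auto simp: eventually_nhds_metric)
  then show "D = 0"
    using DERIV_local_min[OF g, of d] by (auto simp: dist_real_def)
  then have "((\<lambda>h. (g (0 + h) - g 0) / h) \<longlongrightarrow> 0) (at 0)"
    using g by (simp add: DERIV_def)
  then have lim: "((\<lambda>h. \<bar>(g h - g 0) / h\<bar>) \<longlongrightarrow> 0) (at 0)"
    using tendsto_rabs_zero by fastforce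
  \<comment> \<open>Both numerators are nonnegative and the first is at most the second, so the
    absolute quotients compare for either sign of \<open>h\<close>.\<close>
  have "\<forall>\<^sub>F h in at 0. norm ((f (x + h) - f x) / h) \<le> \<bar>(g h - g 0) / h\<bar>"
    using bnd unfolding eventually_at_filter
    by eventually_elim (auto simp: abs_divide assms(3) intro!: divide_right_mono)
  then have "((\<lambda>h. (f (x + h) - f x) / h) \<longlongrightarrow> 0) (at 0)"
    using lim by (rule Lim_null_comparison)
  then show "(f has_real_derivative 0) (at x)"
    by (simp add: DERIV_def)
qed

text \<open>A nonempty compact convex subset of a line is a segment; the parameters of its two ends
  lie between \<open>- \<beta>\<close> and \<alpha>, so they differ by at most
  \<open>\<alpha> + \<beta>\<close>.\<close>

lemma segment_length_line_Int_le:
  fixes C :: "(real^2) set"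
  assumes "compact C" "convex C" "Z \<in> C"
    and bnd: "\<And>t. Z + t *\<^sub>R v \<in> C \<Longrightarrow> - \<beta> \<le> t \<and> t \<le> \<alpha>"
  shows "segment_length (range (\<lambda>t. Z + t *\<^sub>R v) \<inter> C) \<le> norm v * (\<alpha> + \<beta>)"
proof -
  let ?L = "range (\<lambda>t. Z + t *\<^sub>R v)"
  have L: "?L = affine hull {Z, Z + v}"
    by (simp add: affine_hull_2_alt)
  have "compact (?L \<inter> C)" "convex (?L \<inter> C)"
    unfolding L using assms
    by (auto intro!: closed_Int_compact closed_affine_hull convex_Int convex_affine_hull)
  moreover have "collinear (?L \<inter> C)"
    unfolding L by (meson collinear_affine_hull Int_lower1)
  moreover have "Z \<in> ?L \<inter> C"
    using assms(3) by (auto intro!: image_eqI[of _ _ 0])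
  ultimately obtain P Q where PQ: "?L \<inter> C = closed_segment P Q"
    by (metis compact_convex_collinear_segment empty_iff)
  then have "P \<in> ?L \<inter> C" "Q \<in> ?L \<inter> C"
    by auto
  then obtain s t where st: "P = Z + s *\<^sub>R v" "Q = Z + t *\<^sub>R v" "P \<in> C" "Q \<in> C"
    by blast
  then have "dist P Q = norm v * \<bar>s - t\<bar>"
    by (simp add: dist_norm flip: scaleR_left_diff_distrib)
  also have "\<dots> \<le> norm v * (\<alpha> + \<beta>)"
    using bnd[of s] bnd[of t] st by (intro mult_left_mono) auto
  finally show ?thesis
    by (simp add: PQ)
qed

text \<open>Here \<open>slope n\<close> is the tangent of the angle from \<open>w\<close> to
  \<open>n\<close>. The positivity conditions say that the turned direction still heads towards the
  line with normal \<open>n\<close>, and its opposite towards the line with normal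
  \<open>m\<close>.\<close>

lemma supported_chord_bounds:
  fixes w :: "real^2"
  defines "slope \<equiv> \<lambda>n. (n \<bullet> quarter_turn w) / (n \<bullet> w)"
  assumes n: "n \<bullet> w > 0" "n \<bullet> x \<le> n \<bullet> (Z + w)"
    and m: "m \<bullet> w < 0" "m \<bullet> x \<le> m \<bullet> (Z - k *\<^sub>R w)"
    and x: "x = Z + t *\<^sub>R (cos h *\<^sub>R w + sin h *\<^sub>R quarter_turn w)"
    and pos: "cos h + slope n * sin h > 0" "cos h + slope m * sin h > 0"
  shows "t \<le> 1 / (cos h + slope n * sin h)" "- (k / (cos h + slope m * sin h)) \<le> t"
proof -
  have *: "c \<bullet> w * (t * (cos h + slope c * sin h)) = c \<bullet> x - c \<bullet> Z" if "c \<bullet> w \<noteq> 0" for c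
    using that by (simp add: x slope_def inner_simps field_simps)
  have "n \<bullet> w * (t * (cos h + slope n * sin h)) \<le> n \<bullet> w * 1"
    using n *[of n] by (simp add: inner_simps)
  then have "t * (cos h + slope n * sin h) \<le> 1"
    using n(1) by (simp only: mult_le_cancel_left_pos)
  then show "t \<le> 1 / (cos h + slope n * sin h)"
    using pos by (simp add: pos_le_divide_eq)
  \<comment> \<open>As \<open>m \<bullet> w\<close> is negative, cancelling it reverses the
    inequality: the second support condition bounds \<open>t\<close> from below.\<close>
  have "m \<bullet> w * (t * (cos h + slope m * sin h)) \<le> m \<bullet> w * (- k)"
    using m *[of m] by (simp add: inner_simps algebra_simps)
  then have "- k \<le> t * (cos h + slope m * sin h)"
    using m(1) by (simp only: mult_le_cancel_left_neg)
  then show "- (k / (cos h + slope m * sin h)) \<le> t"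
    using pos unfolding minus_divide_left by (simp only: pos_divide_le_eq)
qed

lemma minimal_chord_slopes:
  fixes C l0 :: "(real^2) set" and Z w :: "real^2"
  defines "f \<equiv> \<lambda>\<phi>. segment_length (rotated_line Z l0 \<phi> \<inter> C)"
    and "slope \<equiv> \<lambda>n. (n \<bullet> quarter_turn w) / (n \<bullet> w)"
  assumes C: "compact C" "convex C" "Z \<in> C"
    and l0: "is_line l0" "Z \<in> l0"
    and min: "local_min_at f \<phi>s"
    and seg: "closed_segment (Z + w) (Z - k *\<^sub>R w) = rotated_line Z l0 \<phi>s \<inter> C"
    and w: "w \<noteq> 0" and k: "k > 0"
    and n: "n \<bullet> w > 0" "\<And>x. x \<in> C \<Longrightarrow> n \<bullet> x \<le> n \<bullet> (Z + w)"
    and m: "m \<bullet> w < 0" "\<And>x. x \<in> C \<Longrightarrow> m \<bullet> x \<le> m \<bullet> (Z - k *\<^sub>R w)"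
  shows "slope n + k * slope m = 0" "(f has_real_derivative 0) (at \<phi>s)"
proof -
  define g where "g h = norm w * (1 / (cos h + slope n * sin h) + k / (cos h + slope m * sin h))" for h
  have "Z + w \<in> rotated_line Z l0 \<phi>s"
    using seg by auto
  then have line: "rotated_line Z l0 (\<phi>s + h)
      = range (\<lambda>t. Z + t *\<^sub>R (cos h *\<^sub>R w + sin h *\<^sub>R quarter_turn w))" for h
    using rotated_line_eq_range[OF l0, of "Z + w" \<phi>s h] w by simp
  \<comment> \<open>The expression equals 1 at \<open>h = 0\<close>, so continuity keeps the
    denominators of \<open>g\<close> positive near 0.\<close>
  have pos: "\<forall>\<^sub>F h in nhds 0. cos h + c * sin h > 0" for c :: real
  proof -
    have "isCont (\<lambda>h. cos h + c * sin h) 0"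
      by (intro continuous_intros)
    then have "((\<lambda>h. cos h + c * sin h) \<longlongrightarrow> 1) (nhds 0)"
      using tendsto_at_iff_tendsto_nhds[of "\<lambda>h. cos h + c * sin h" 0] by (simp add: isCont_def)
    then show ?thesis
      by (rule order_tendstoD) simp
  qed
  have "\<forall>\<^sub>F h in nhds 0. f (\<phi>s + h) \<le> g h"
    using pos[of "slope n"] pos[of "slope m"]
  proof eventually_elim
    case (elim h)
    have "f (\<phi>s + h) \<le> norm (cos h *\<^sub>R w + sin h *\<^sub>R quarter_turn w)
        * (1 / (cos h + slope n * sin h) + k / (cos h + slope m * sin h))"
      unfolding f_def line
      using supported_chord_bounds[OF n m] elim
      by (intro segment_length_line_Int_le C) (auto simp: slope_def)
    then show ?case
      by (simp add: g_def norm_cos_sin_quarter_turn)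
  qed
  \<comment> \<open>The bound is attained at \<open>h = 0\<close>, where the chord itself runs from
    \<open>Z + w\<close> to \<open>Z - k *\<^sub>R w\<close>.\<close>
  moreover have "g 0 = f \<phi>s"
  proof -
    have "f \<phi>s = norm ((1 + k) *\<^sub>R w)"
      by (simp add: f_def dist_norm algebra_simps flip: seg)
    then show ?thesis
      using k by (simp add: g_def)
  qed
  moreover have "(g has_real_derivative - (norm w * (slope n + k * slope m))) (at 0)"
    unfolding g_def by (auto intro!: derivative_eq_intros simp: algebra_simps)
  ultimately have "- (norm w * (slope n + k * slope m)) = 0" "(f has_real_derivative 0) (at \<phi>s)"
    using local_min_squeeze[OF min] by blast+
  then show "slope n + k * slope m = 0" "(f has_real_derivative 0) (at \<phi>s)"
    using w by auto
qed

section \<open>Lines and perpendiculars expressed by slopes\<close>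

lemma hyperplane_eqI_slope:
  fixes w :: "real^2"
  assumes "n \<bullet> w \<noteq> 0" "n' \<bullet> w \<noteq> 0"
    and "(n \<bullet> quarter_turn w) / (n \<bullet> w) = (n' \<bullet> quarter_turn w) / (n' \<bullet> w)"
  shows "{x. n \<bullet> x = n \<bullet> A} = {x. n' \<bullet> x = n' \<bullet> A}"
proof -
  \<comment> \<open>In coordinates along \<open>w\<close> and its quarter turn, dividing the
    equation of the line by \<open>c \<bullet> w\<close> leaves \<open>c\<close> present only
    through its slope.\<close>
  have *: "c \<bullet> x = c \<bullet> A \<longleftrightarrow>
      (x - A) \<bullet> w + (x - A) \<bullet> quarter_turn w * ((c \<bullet> quarter_turn w) / (c \<bullet> w)) = 0"
    if "c \<bullet> w \<noteq> 0" for c x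
  proof -
    have "w \<bullet> w \<noteq> 0"
      using that by auto
    then have "c \<bullet> x = c \<bullet> A \<longleftrightarrow> (w \<bullet> w) * ((x - A) \<bullet> c) = 0"
      by (auto simp: inner_diff_right inner_commute[of _ c])
    also have "(w \<bullet> w) * ((x - A) \<bullet> c) = (c \<bullet> w)
        * ((x - A) \<bullet> w + (x - A) \<bullet> quarter_turn w * ((c \<bullet> quarter_turn w) / (c \<bullet> w)))"
      unfolding inner_quarter_turn_decomposition using that by (simp add: field_simps)
    finally show ?thesis
      using that by simp
  qed
  show ?thesis
    using *[OF assms(1)] *[OF assms(2)] assms(3) by auto
qed

text \<open>The vector multiplied by \<open>c\<close> is \<open>n\<close> scaled by
  \<open>(w \<bullet> w) / (n \<bullet> w)\<close>, so it is normal to the line; its component along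
  \<open>w\<close> is normalized to 1.\<close>

lemma mem_perpendicular_at_hyperplane:
  fixes w :: "real^2"
  assumes "n \<bullet> w \<noteq> 0"
  shows "A + c *\<^sub>R (w + ((n \<bullet> quarter_turn w) / (n \<bullet> w)) *\<^sub>R quarter_turn w)
    \<in> perpendicular_at {x. n \<bullet> x = b} A"
proof -
  let ?q = "quarter_turn w"
  have "(w + ((n \<bullet> ?q) / (n \<bullet> w)) *\<^sub>R ?q) \<bullet> (Y - Y') = 0"
    if "n \<bullet> Y = b" "n \<bullet> Y' = b" for Y Y'
  proof -
    let ?D = "Y - Y'"
    have "(n \<bullet> w) * (w \<bullet> ?D) + (n \<bullet> ?q) * (?q \<bullet> ?D) = (w \<bullet> w) * (n \<bullet> ?D)"
      by (simp add: inner_quarter_turn_decomposition inner_commute)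
    also have "\<dots> = 0"
      using that by (simp add: inner_diff_right)
    finally show ?thesis
      using assms by (simp add: inner_add_left field_simps)
  qed
  then show ?thesis
    by (auto simp: perpendicular_at_def orthogonal_def)
qed

lemma CPP_of_slopes:
  fixes w Z :: "real^2" and k :: real
  defines "slope \<equiv> \<lambda>n. (n \<bullet> quarter_turn w) / (n \<bullet> w)"
    and "A \<equiv> Z + w" and "B \<equiv> Z - k *\<^sub>R w"
  assumes "k > 0" "n \<bullet> w \<noteq> 0" "m \<bullet> w \<noteq> 0" "slope n + k * slope m = 0"
  shows "CPP {x. n \<bullet> x = n \<bullet> A} {x. m \<bullet> x = m \<bullet> B} (affine hull {A, B}) A B Z"
proof -
  \<comment> \<open>Moving from \<open>A\<close> by -1 times its normalized normal, or from
    \<open>B\<close> by \<open>k\<close> times its own, cancels the offset along \<open>w\<close>.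
    The remaining quarter-turn parts, \<open>- slope n\<close> and \<open>k * slope m\<close>, agree
    by the slope relation.\<close>
  let ?X = "Z - slope n *\<^sub>R quarter_turn w"
  have neq: "n \<noteq> 0" "m \<noteq> 0" "w \<noteq> 0"
    using assms by auto
  have "(1 + k) *\<^sub>R w \<noteq> 0"
    using neq \<open>k > 0\<close> by simp
  moreover have diff: "B - A = - ((1 + k) *\<^sub>R w)"
    by (simp add: A_def B_def algebra_simps)
  ultimately have AB: "A \<noteq> B"
    by auto
  have hull: "affine hull {A, B} = range (\<lambda>t. A + t *\<^sub>R (B - A))"
    by (simp add: affine_hull_2_alt)
  \<comment> \<open>Since \<open>B - A\<close> is \<open>- ((1 + k) *\<^sub>R w)\<close>, this
    fraction of it is \<open>- w\<close>, which leads from \<open>A\<close> back to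
    \<open>Z\<close>.\<close>
  have "Z = A + (1 / (1 + k)) *\<^sub>R (B - A)"
    using \<open>k > 0\<close> unfolding diff by (simp add: A_def)
  then have "Z \<in> affine hull {A, B}"
    unfolding hull by blast
  moreover have "is_line (affine hull {A, B})"
    using AB by (simp add: is_line_def aff_dim_2)
  moreover have "?X \<in> perpendicular_at {x. n \<bullet> x = n \<bullet> A} A"
    using mem_perpendicular_at_hyperplane[OF \<open>n \<bullet> w \<noteq> 0\<close>, of A "-1"]
    by (simp add: A_def slope_def)
  moreover have "?X \<in> perpendicular_at {x. m \<bullet> x = m \<bullet> B} B"
  proof -
    have "slope n = - (k * slope m)"
      using assms(7) by simp
    then have "?X = B + k *\<^sub>R (w + slope m *\<^sub>R quarter_turn w)"
      by (simp add: B_def algebra_simps)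
    then show ?thesis
      using mem_perpendicular_at_hyperplane[OF \<open>m \<bullet> w \<noteq> 0\<close>, of B k] by (simp add: slope_def)
  qed
  moreover have "?X \<in> perpendicular_at (affine hull {A, B}) Z"
    unfolding hull diff perpendicular_at_def orthogonal_def
    by (auto simp: inner_diff_right)
  ultimately show ?thesis
    unfolding CPP_def using neq by (auto simp: is_line_hyperplane hull_inc)
qed

section \<open>From the minimal chord to perpendiculars, uniqueness and derivative\<close>

theorem proposition5:
  fixes C :: "(real^2) set" and Z :: "real^2" and l0 :: "(real^2) set"
    and f :: "real \<Rightarrow> real" and \<phi>s :: real and As Bs :: "real^2"
  defines "f \<equiv> \<lambda>\<phi>. segment_length (rotated_line Z l0 \<phi> \<inter> C)"
  assumes "compact C" and "convex C" and "Z \<in> interior C"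
    and "is_line l0" and "Z \<in> l0"
    and "local_min_at f \<phi>s"
    and "closed_segment As Bs = rotated_line Z l0 \<phi>s \<inter> C"
  shows "(\<forall>l1 l2. supporting_line C As l1 \<and> supporting_line C Bs l2 \<longrightarrow>
             CPP l1 l2 (affine hull {As, Bs}) As Bs Z)
         \<and> Z \<in> closed_segment As Bs
         \<and> (\<exists>!p. supporting_line C As p) \<and> (\<exists>!p. supporting_line C Bs p)
         \<and> (f has_real_derivative 0) (at \<phi>s)"
proof -
  have "Z \<in> C"
    using assms(4) interior_subset by auto
  obtain v where v: "v \<noteq> 0" "rotated_line Z l0 \<phi>s = range (\<lambda>t. Z + t *\<^sub>R v)"
    using rotated_line_obtain_direction assms(5,6) by blast
  have nint: "As \<notin> interior C" "Bs \<notin> interior C"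
    using chord_endpoint_not_interior[OF v(1)] assms(8) v(2) closed_segment_commute by metis+
  have "Z \<in> rotated_line Z l0 \<phi>s"
    unfolding v(2) by (rule image_eqI[of _ _ 0]) auto
  with \<open>Z \<in> C\<close> have Zseg: "Z \<in> closed_segment As Bs"
    using assms(8) by auto
  then obtain u where u: "0 \<le> u" "u \<le> 1" "Z = (1 - u) *\<^sub>R As + u *\<^sub>R Bs"
    by (auto simp: in_segment)
  \<comment> \<open>At \<open>u = 0\<close> or \<open>u = 1\<close> the interior point
    \<open>Z\<close> would be a chord endpoint.\<close>
  then have u01: "0 < u" "u < 1"
    using nint assms(4) by (auto simp: less_le)
  define w where "w = As - Z"
  \<comment> \<open>Solving the convex combination for \<open>Bs - Z\<close> gives
    \<open>- ((1 - u) / u)\<close> times \<open>As - Z\<close>.\<close>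
  define k where "k = (1 - u) / u"
  define slope where "slope n = (n \<bullet> quarter_turn w) / (n \<bullet> w)" for n
  have k: "k > 0"
    using u01 by (simp add: k_def)
  have As: "As = Z + w"
    by (simp add: w_def)
  have Bs: "Bs = Z - k *\<^sub>R w"
  proof -
    have "u * k = 1 - u"
      using u01 by (simp add: k_def)
    then have "u *\<^sub>R (Z - k *\<^sub>R w) = u *\<^sub>R Z - (1 - u) *\<^sub>R w"
      by (simp add: scaleR_diff_right)
    also have "\<dots> = Z - (1 - u) *\<^sub>R As"
      by (simp add: w_def algebra_simps)
    also have "\<dots> = u *\<^sub>R Bs"
      by (simp add: u(3))
    finally show ?thesis
      using u01 by simp
  qed
  have w: "w \<noteq> 0"
    using nint assms(4) by (auto simp: w_def)
  \<comment> \<open>The interior point \<open>Z\<close> is strictly inside each supporting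
    half-plane, so every supporting line at an endpoint crosses the chord transversally. This fixes
    the sign of \<open>n \<bullet> w\<close>, with the opposite sign at \<open>Bs\<close>.\<close>
  have suppA: "\<exists>n. n \<bullet> w > 0 \<and> p = {x. n \<bullet> x = n \<bullet> As} \<and> (\<forall>x\<in>C. n \<bullet> x \<le> n \<bullet> As)"
    if p: "supporting_line C As p" for p
  proof -
    obtain n where n: "n \<noteq> 0" "p = {x. n \<bullet> x = n \<bullet> As}" "\<And>x. x \<in> C \<Longrightarrow> n \<bullet> x \<le> n \<bullet> As"
      using supporting_lineE[OF p] by blast
    have "n \<bullet> Z < n \<bullet> As"
      using interior_point_strict_support[OF n(1,3) assms(4)] .
    then have "n \<bullet> w > 0"
      by (simp add: As inner_simps)
    with n(2,3) show ?thesis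
      by (intro exI[of _ n]) simp
  qed
  have suppB: "\<exists>m. m \<bullet> w < 0 \<and> p = {x. m \<bullet> x = m \<bullet> Bs} \<and> (\<forall>x\<in>C. m \<bullet> x \<le> m \<bullet> Bs)"
    if p: "supporting_line C Bs p" for p
  proof -
    obtain m where m: "m \<noteq> 0" "p = {x. m \<bullet> x = m \<bullet> Bs}" "\<And>x. x \<in> C \<Longrightarrow> m \<bullet> x \<le> m \<bullet> Bs"
      using supporting_lineE[OF p] by blast
    have "m \<bullet> Z < m \<bullet> Bs"
      using interior_point_strict_support[OF m(1,3) assms(4)] .
    then have "m \<bullet> w < 0"
      using k by (simp add: Bs inner_simps mult_less_0_iff)
    with m(2,3) show ?thesis
      by (intro exI[of _ m]) simp
  qed
  have slopes: "slope n + k * slope m = 0 \<and> (f has_real_derivative 0) (at \<phi>s)"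
    if "n \<bullet> w > 0" "\<forall>x\<in>C. n \<bullet> x \<le> n \<bullet> As" "m \<bullet> w < 0" "\<forall>x\<in>C. m \<bullet> x \<le> m \<bullet> Bs" for n m
  proof -
    note chord = minimal_chord_slopes[OF assms(2,3) \<open>Z \<in> C\<close> assms(5,6) assms(7)[unfolded f_def]
        assms(8)[unfolded As Bs] w k]
    show ?thesis
      unfolding slope_def f_def using that
      by (intro conjI chord[of n m]) (simp_all flip: As Bs)
  qed
  have "As \<in> C" "Bs \<in> C"
    using assms(8) by auto
  then have "\<exists>p. supporting_line C As p" "\<exists>p. supporting_line C Bs p"
    using supporting_line_exists[OF assms(3)] nint assms(4) by blast+
  then obtain p0 q0 where p0: "supporting_line C As p0" and q0: "supporting_line C Bs q0"
    by blast
  \<comment> \<open>One reference normal at each end: it serves as the fixed partner when two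
    supporting lines at the other end are compared, and the pair yields the derivative.\<close>
  obtain n0 where n0: "n0 \<bullet> w > 0" "\<forall>x\<in>C. n0 \<bullet> x \<le> n0 \<bullet> As"
    using suppA[OF p0] by blast
  obtain m0 where m0: "m0 \<bullet> w < 0" "\<forall>x\<in>C. m0 \<bullet> x \<le> m0 \<bullet> Bs"
    using suppB[OF q0] by blast
  have "CPP l1 l2 (affine hull {As, Bs}) As Bs Z"
    if l1: "supporting_line C As l1" and l2: "supporting_line C Bs l2" for l1 l2
  proof -
    obtain n where n: "n \<bullet> w > 0" "l1 = {x. n \<bullet> x = n \<bullet> As}" "\<forall>x\<in>C. n \<bullet> x \<le> n \<bullet> As"
      using suppA[OF l1] by blast
    obtain m where m: "m \<bullet> w < 0" "l2 = {x. m \<bullet> x = m \<bullet> Bs}" "\<forall>x\<in>C. m \<bullet> x \<le> m \<bullet> Bs"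
      using suppB[OF l2] by blast
    show ?thesis
      using CPP_of_slopes[OF k, of n w m Z] slopes[OF n(1,3) m(1,3)] n(1) m(1)
      unfolding n(2) m(2) slope_def As Bs by auto
  qed
  moreover have "p = p'" if pp: "supporting_line C As p" "supporting_line C As p'" for p p'
  proof -
    obtain n where n: "n \<bullet> w > 0" "p = {x. n \<bullet> x = n \<bullet> As}" "\<forall>x\<in>C. n \<bullet> x \<le> n \<bullet> As"
      using suppA[OF pp(1)] by blast
    obtain n' where n': "n' \<bullet> w > 0" "p' = {x. n' \<bullet> x = n' \<bullet> As}" "\<forall>x\<in>C. n' \<bullet> x \<le> n' \<bullet> As"
      using suppA[OF pp(2)] by blast
    \<comment> \<open>Paired with the same \<open>m0\<close>, both slopes equal
      \<open>- k * slope m0\<close>.\<close>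
    have "slope n = slope n'"
      using slopes[OF n(1,3) m0] slopes[OF n'(1,3) m0] by linarith
    then show ?thesis
      unfolding n(2) n'(2) using n(1) n'(1)
      by (intro hyperplane_eqI_slope[of n w n']) (auto simp: slope_def)
  qed
  moreover have "p = p'" if pp: "supporting_line C Bs p" "supporting_line C Bs p'" for p p'
  proof -
    obtain m where m: "m \<bullet> w < 0" "p = {x. m \<bullet> x = m \<bullet> Bs}" "\<forall>x\<in>C. m \<bullet> x \<le> m \<bullet> Bs"
      using suppB[OF pp(1)] by blast
    obtain m' where m': "m' \<bullet> w < 0" "p' = {x. m' \<bullet> x = m' \<bullet> Bs}" "\<forall>x\<in>C. m' \<bullet> x \<le> m' \<bullet> Bs"
      using suppB[OF pp(2)] by blast
    have "k * slope m = k * slope m'"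
      using slopes[OF n0 m(1,3)] slopes[OF n0 m'(1,3)] by linarith
    then have "slope m = slope m'"
      using k by simp
    then show ?thesis
      unfolding m(2) m'(2) using m(1) m'(1)
      by (intro hyperplane_eqI_slope[of m w m']) (auto simp: slope_def)
  qed
  moreover have "(f has_real_derivative 0) (at \<phi>s)"
    using slopes[OF n0 m0] by blast
  ultimately show ?thesis
    using Zseg p0 q0 by (intro conjI allI impI ex1I[of _ p0] ex1I[of _ q0]) simp_all
qed

end
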